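(* Suppose all agents have identical uncertainty classes: $\epsilon_{0,k}=\epsilon_0$ and $\epsilon_{1,k}=\epsilon_1$ for all $k\ge1$. Suppose the decision rule $\phi_k$ of each agent $k\ge 1$ is chosen sequentially so as to minimize $P_k^{\mathrm{SL}}(\phi_k\mid\phi^{(k-1)})$. Then $P_k^{\mathrm{SL}}(\phi_k\mid\phi^{(k-1)})\to0$ as $k\to\infty$ if and only if $\epsilon_0=\epsilon_1=0$ and the log-likelihood ratio of $P_1^*$ versus $P_0^*$ is unbounded.
   Context: Infinite tandem network: agents $1,2,\dots$; the true hypothesis $H$ is $H_i$ with prior probability $\pi_i\in(0,1)$, $i=0,1$, $\pi_0+\pi_1=1$. Conditioned on $H=H_i$, agent $k$ observes $Y_k$ in a measurable space $(\mathcal{Y},\mathcal{A})$ with (unknown) distribution $P_{i,k}$ in the uncertainty class $\mathcal{P}_{i,k}=\{(1-\epsilon_{i,k})P_i^*+\epsilon_{i,k}R : R\in\mathcal{R}\}$, where $\mathcal{R}$ is the set of all probability measures on $(\mathcal{Y},\mathcal{A})$, $P_i^*\in\mathcal{R}$ is the nominal distribution (the same for all agents), and the contamination $\epsilon_{i,k}\in[0,1)$ is small enough that $\mathcal{P}_{0,k}$ and $\mathcal{P}_{1,k}$ are disjoint. All distributions in $\mathcal{P}_{0,k}$ and $\mathcal{P}_{1,k}$ are assumed absolutely continuous with respect to one another. Given $H$, the observations are independent across agents. Agent $k$ decides $U_k=\phi_k(Y_k,U_{k-1})\in\{0,1\}$, with $U_0\equiv 0$, where $\phi_k$ is its decision rule;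 $\phi^{(k)}=(\phi_1,\dots,\phi_k)$. $\mathcal{P}_i^{(k)}=\mathcal{P}_{i,1}\times\cdots\times\mathcal{P}_{i,k}$; an element $P_i^{(k)}=P_{i,1}\times\cdots\times P_{i,k}$ is the product law of $(Y_1,\dots,Y_k)$ under $H_i$. $P_{e,k}(\phi^{(k)},P_0^{(k)},P_1^{(k)})=\pi_0P_0^{(k)}(U_k=1)+\pi_1P_1^{(k)}(U_k=0)$. Social learning criterion of agent $k$, given the rules $\phi^{(k-1)}$ already chosen by agents $1,\dots,k-1$: $P_k^{\mathrm{SL}}(\phi_k\mid\phi^{(k-1)})=\sup_{(P_0^{(k)},P_1^{(k)})\in\mathcal{P}_0^{(k)}\times\mathcal{P}_1^{(k)}}P_{e,k}(\phi^{(k)},P_0^{(k)},P_1^{(k)})$ (for $k=1$ there is no conditioning). The log-likelihood ratio of $P_1^*$ versus $P_0^*$ is $\log(p_1^*/p_0^* )$ with $p_i^*$ the density of $P_i^*$ with respect to a common measure.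
   Formalization: "Unbounded" log-likelihood ratio is taken to mean essentially unbounded both from above and from below; if it is unbounded on one side only (e.g. P_0* uniform on (0,1), P_1* with density 2y, no contamination), the error does not tend to 0. *)

theory Defs
  imports "HOL-Probability.Probability"
begin

text \<open>
  A measure \<open>M\<close> plays the role of the measurable space in which every agent's observation
  lives; only its carrier and its \<open>\<sigma>\<close>-algebra matter. Agents are numbered \<open>1, 2, \<dots>\<close>, so families
  indexed by \<open>nat\<close> are only ever used at indices \<open>\<ge> 1\<close>. Decisions \<open>0\<close> and \<open>1\<close> are encoded
  as \<open>False\<close> and \<open>True\<close>.
\<close>

text \<open>The mixtures \<open>(1 - \<epsilon>) P + \<epsilon> R\<close>, with \<open>R\<close> ranging over all probability measures on \<open>M\<close>;
  the equation on measurable sets determines the mixture.\<close>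

definition uncertainty_class :: "'y measure \<Rightarrow> 'y measure \<Rightarrow> real \<Rightarrow> 'y measure set" where
  "uncertainty_class M P \<epsilon> =
     {Q \<in> space (prob_algebra M). \<exists>R\<in>space (prob_algebra M).
        \<forall>B\<in>sets M. measure Q B = (1 - \<epsilon>) * measure P B + \<epsilon> * measure R B}"

definition product_class ::
    "'y measure \<Rightarrow> 'y measure \<Rightarrow> (nat \<Rightarrow> real) \<Rightarrow> nat \<Rightarrow> (nat \<Rightarrow> 'y) measure set" where
  "product_class M P \<epsilon> k =
     {PiM {1..k} Q | Q. \<forall>j\<in>{1..k}. Q j \<in> uncertainty_class M P (\<epsilon> j)}"

definition decision_rules :: "'y measure \<Rightarrow> ('y \<times> bool \<Rightarrow> bool) set" where
  "decision_rules M = measurable (M \<Otimes>\<^sub>M count_space UNIV) (count_space UNIV)"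

fun decision :: "(nat \<Rightarrow> 'y \<times> bool \<Rightarrow> bool) \<Rightarrow> nat \<Rightarrow> (nat \<Rightarrow> 'y) \<Rightarrow> bool" where
  "decision \<phi> 0 y = False"
| "decision \<phi> (Suc k) y = \<phi> (Suc k) (y (Suc k), decision \<phi> k y)"

definition error_prob ::
    "real \<Rightarrow> real \<Rightarrow> (nat \<Rightarrow> 'y \<times> bool \<Rightarrow> bool) \<Rightarrow> nat \<Rightarrow>
     (nat \<Rightarrow> 'y) measure \<Rightarrow> (nat \<Rightarrow> 'y) measure \<Rightarrow> real" where
  "error_prob \<pi>0 \<pi>1 \<phi> k \<mu>0 \<mu>1 =
     \<pi>0 * measure \<mu>0 {y \<in> space \<mu>0. decision \<phi> k y} +
     \<pi>1 * measure \<mu>1 {y \<in> space \<mu>1. \<not> decision \<phi> k y}"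

text \<open>Worst-case error of agent \<open>k\<close> when it uses the rule \<open>\<psi>\<close> and the agents \<open>1, \<dots>, k - 1\<close> use
  the rules given by \<open>\<phi>\<close>; the values of \<open>\<phi>\<close> from \<open>k\<close> onwards are irrelevant.\<close>

definition social_learning_risk ::
    "'y measure \<Rightarrow> 'y measure \<Rightarrow> 'y measure \<Rightarrow> (nat \<Rightarrow> real) \<Rightarrow> (nat \<Rightarrow> real) \<Rightarrow> real \<Rightarrow> real \<Rightarrow>
     nat \<Rightarrow> ('y \<times> bool \<Rightarrow> bool) \<Rightarrow> (nat \<Rightarrow> 'y \<times> bool \<Rightarrow> bool) \<Rightarrow> real" where
  "social_learning_risk M P0 P1 \<epsilon>0 \<epsilon>1 \<pi>0 \<pi>1 k \<psi> \<phi> =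
     (SUP (\<mu>0, \<mu>1) \<in> product_class M P0 \<epsilon>0 k \<times> product_class M P1 \<epsilon>1 k.
        error_prob \<pi>0 \<pi>1 (\<phi>(k := \<psi>)) k \<mu>0 \<mu>1)"

definition log_likelihood_ratio :: "('y \<Rightarrow> real) \<Rightarrow> ('y \<Rightarrow> real) \<Rightarrow> 'y \<Rightarrow> real" where
  "log_likelihood_ratio p1 p0 y = ln (p1 y / p0 y)"

text \<open>Unboundedness is meant as usual in social learning: essentially unbounded both from above
  and from below. It is used with \<open>P\<close> one of two mutually absolutely continuous nominal
  distributions; then both densities are positive \<open>P\<close>-almost everywhere, so the totalised values
  of division and \<open>ln\<close> at \<open>0\<close> play no role, and it does not matter which of the two is taken.\<close>

definition ess_unbounded :: "'y measure \<Rightarrow> ('y \<Rightarrow> real) \<Rightarrow> bool" where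
  "ess_unbounded P f \<longleftrightarrow>
     \<not> (\<exists>c. AE y in P. f y \<le> c) \<and> \<not> (\<exists>c. AE y in P. c \<le> f y)"

end

theory Submission
  imports Defs
begin

text \<open>
  The law of the decision process satisfies a two-state Markov recursion, driven under each
  hypothesis by the probabilities of the sets of observations that switch the decision.

  If the risk tends to \<open>0\<close>, then either contamination or a likelihood ratio bounded on one side
  makes one of the two decisions eventually irrevocable. With contamination at rate \<open>e\<close>, an
  observation that could switch a right decision to a wrong one could be given mass \<open>e\<close>, so no
  such observation exists eventually; with a one-sided bound, overriding the nearly certain
  decision of the predecessor would increase the risk unless it happens with probability \<open>0\<close>.
  The probability that this decision is the wrong one then no longer decreases, and it is
  positive, a contradiction.

  Conversely, when the likelihood ratio is unbounded on both sides and the risk is at least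
  \<open>R > 0\<close>, one type of error contributes at least \<open>R / 2\<close>. Overriding the corresponding decision on
  observations whose likelihood ratio against it exceeds \<open>4 / R\<close> lowers the risk by an amount
  depending on \<open>R\<close> only, so the risk cannot stay above \<open>R\<close>.
\<close>

section \<open>The decision process as a two-state Markov chain\<close>

definition switch_set ::
    "'y measure \<Rightarrow> (nat \<Rightarrow> 'y \<times> bool \<Rightarrow> bool) \<Rightarrow> nat \<Rightarrow> bool \<Rightarrow> bool \<Rightarrow> 'y set" where
  "switch_set M \<phi> k u v = {y \<in> space M. \<phi> k (y, u) = v}"

text \<open>For \<open>k = 0\<close> the product is the one-point space, so the chain starts at
  \<open>False\<close>.\<close>

definition state_prob ::
    "(nat \<Rightarrow> 'y \<times> bool \<Rightarrow> bool) \<Rightarrow> (nat \<Rightarrow> 'y measure) \<Rightarrow> nat \<Rightarrow> bool \<Rightarrow> real" where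
  "state_prob \<phi> Q k u = measure (PiM {1..k} Q) {y \<in> space (PiM {1..k} Q). decision \<phi> k y = u}"

lemma prob_algebraD:
  assumes "P \<in> space (prob_algebra M)"
  shows "sets P = sets M" "space P = space M" "prob_space P"
  using assms sets_eq_imp_space_eq[of P M] by (auto simp: space_prob_algebra)

lemma switch_set_sets:
  assumes "\<phi> k \<in> decision_rules M"
  shows "switch_set M \<phi> k u v \<in> sets M"
proof -
  have [measurable]: "\<phi> k \<in> measurable (M \<Otimes>\<^sub>M count_space UNIV) (count_space UNIV)"
    using assms by (simp add: decision_rules_def)
  show ?thesis unfolding switch_set_def by measurable
qed

lemma decision_cong:
  assumes "\<And>j. j \<in> {1..k} \<Longrightarrow> \<phi> j = \<phi>' j" "\<And>j. j \<in> {1..k} \<Longrightarrow> y j = y' j"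
  shows "decision \<phi> k y = decision \<phi>' k y'"
  using assms by (induction k) auto

text \<open>The index set \<open>I\<close> is kept apart from \<open>{1..k}\<close> so that the
  induction on \<open>k\<close> can stay in one product space.\<close>

lemma measurable_decision:
  assumes "\<And>j. j \<in> {1..k} \<Longrightarrow> \<phi> j \<in> decision_rules M"
    and "{1..k} \<subseteq> I" and sets: "\<And>j. j \<in> I \<Longrightarrow> sets (Q j) = sets M"
  shows "decision \<phi> k \<in> measurable (PiM I Q) (count_space UNIV)"
  using assms(1,2)
proof (induction k)
  case 0
  have "decision \<phi> 0 = (\<lambda>_. False)" by auto
  then show ?case by simp
next
  case (Suc k)
  have IH [measurable]: "decision \<phi> k \<in> measurable (PiM I Q) (count_space UNIV)"
    using Suc.prems by (intro Suc.IH) auto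
  have [measurable]: "\<phi> (Suc k) \<in> measurable (M \<Otimes>\<^sub>M count_space UNIV) (count_space UNIV)"
    using Suc.prems by (simp add: decision_rules_def)
  have "Suc k \<in> I" using Suc.prems by auto
  then have "(\<lambda>y. y (Suc k)) \<in> measurable (PiM I Q) (Q (Suc k))"
    by (rule measurable_component_singleton)
  then have [measurable]: "(\<lambda>y. y (Suc k)) \<in> measurable (PiM I Q) M"
    using measurable_cong_sets[OF refl sets[OF \<open>Suc k \<in> I\<close>]] by blast
  have "(\<lambda>y. \<phi> (Suc k) (y (Suc k), decision \<phi> k y)) \<in> measurable (PiM I Q) (count_space UNIV)"
    by measurable
  also have "(\<lambda>y. \<phi> (Suc k) (y (Suc k), decision \<phi> k y)) = decision \<phi> (Suc k)"
    by (rule ext) simp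
  finally show ?case .
qed

lemma state_prob_bounds:
  assumes "\<And>j. j \<in> {1..k} \<Longrightarrow> prob_space (Q j)"
  shows "0 \<le> state_prob \<phi> Q k u" "state_prob \<phi> Q k u \<le> 1"
  unfolding state_prob_def by (simp, intro prob_space.prob_le_1 prob_space_PiM assms)

lemma state_prob_add:
  assumes \<phi>: "\<And>j. j \<ge> 1 \<Longrightarrow> \<phi> j \<in> decision_rules M"
    and Q: "\<And>j. Q j \<in> space (prob_algebra M)"
  shows "state_prob \<phi> Q k u + state_prob \<phi> Q k (\<not> u) = 1"
proof -
  interpret prob_space "PiM {1..k} Q"
    using Q by (intro prob_space_PiM) (simp add: space_prob_algebra)
  have [measurable]: "decision \<phi> k \<in> measurable (PiM {1..k} Q) (count_space UNIV)"
    using \<phi> Q by (intro measurable_decision) (auto simp: space_prob_algebra)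
  have "{y \<in> space (PiM {1..k} Q). decision \<phi> k y = (\<not> u)} =
      space (PiM {1..k} Q) - {y \<in> space (PiM {1..k} Q). decision \<phi> k y = u}"
    by auto
  moreover have "{y \<in> space (PiM {1..k} Q). decision \<phi> k y = u} \<in> sets (PiM {1..k} Q)"
    by measurable
  ultimately show ?thesis
    unfolding state_prob_def using prob_compl by simp
qed

text \<open>The observation of agent \<open>Suc k\<close> is independent of the first
  \<open>k\<close>, so conditioning on the previous decision gives the transition law. The state
  \<open>w\<close> is free, which lets each use choose the summand that comes first.\<close>

lemma state_prob_Suc:
  assumes \<phi>: "\<And>j. j \<ge> 1 \<Longrightarrow> \<phi> j \<in> decision_rules M"
    and Q: "\<And>j. Q j \<in> space (prob_algebra M)"
  shows "state_prob \<phi> Q (Suc k) v =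
    state_prob \<phi> Q k w * measure (Q (Suc k)) (switch_set M \<phi> (Suc k) w v) +
    state_prob \<phi> Q k (\<not> w) * measure (Q (Suc k)) (switch_set M \<phi> (Suc k) (\<not> w) v)"
proof -
  let ?N = "PiM {1..k} Q" and ?L = "Q (Suc k)"
  have prob: "prob_space (Q j)" and sets: "sets (Q j) = sets M" for j
    using Q[of j] by (auto simp: space_prob_algebra)
  have space: "space (Q j) = space M" for j
    by (rule sets_eq_imp_space_eq[OF sets])
  interpret N: prob_space ?N by (intro prob_space_PiM prob)
  interpret L: prob_space ?L by (rule prob)
  interpret LN: pair_prob_space ?L ?N ..
  have ins: "insert (Suc k) {1..k} = {1..Suc k}" by auto
  have eq: "distr (?L \<Otimes>\<^sub>M ?N) (PiM {1..Suc k} Q) (\<lambda>(x, X). X(Suc k := x)) = PiM {1..Suc k} Q"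
    using distr_pair_PiM_eq_PiM[of "{1..k}" Q "Suc k"] prob unfolding ins by blast
  have upd: "(\<lambda>(x, X). X(Suc k := x)) \<in> measurable (?L \<Otimes>\<^sub>M ?N) (PiM {1..Suc k} Q)"
    unfolding ins[symmetric] by measurable
  have [measurable]: "decision \<phi> (Suc k) \<in> measurable (PiM {1..Suc k} Q) (count_space UNIV)"
    using \<phi> sets by (intro measurable_decision) auto
  have [measurable]: "decision \<phi> k \<in> measurable ?N (count_space UNIV)"
    using \<phi> sets by (intro measurable_decision) auto
  define A where "A u = {y \<in> space ?N. decision \<phi> k y = u}" for u
  define S where "S u = switch_set M \<phi> (Suc k) u v" for u
  have A: "A u \<in> sets ?N" for u unfolding A_def by measurable
  have S: "S u \<in> sets ?L" for u
    using switch_set_sets \<phi> unfolding S_def sets by (metis le_add1 plus_1_eq_Suc)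
  have dec: "decision \<phi> k (X(Suc k := x)) = decision \<phi> k X" for X x
    by (rule decision_cong) auto
  have "state_prob \<phi> Q (Suc k) v =
      measure (distr (?L \<Otimes>\<^sub>M ?N) (PiM {1..Suc k} Q) (\<lambda>(x, X). X(Suc k := x)))
        {y \<in> space (PiM {1..Suc k} Q). decision \<phi> (Suc k) y = v}"
    unfolding eq state_prob_def ..
  also have "\<dots> = measure (?L \<Otimes>\<^sub>M ?N) ((\<lambda>(x, X). X(Suc k := x)) -`
      {y \<in> space (PiM {1..Suc k} Q). decision \<phi> (Suc k) y = v} \<inter> space (?L \<Otimes>\<^sub>M ?N))"
    by (rule measure_distr[OF upd]) measurable
  \<comment> \<open>Splitting by the previous decision, which ignores coordinate
    \<open>Suc k\<close>, turns the event into two disjoint rectangles.\<close>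
  also have "(\<lambda>(x, X). X(Suc k := x)) -`
      {y \<in> space (PiM {1..Suc k} Q). decision \<phi> (Suc k) y = v} \<inter> space (?L \<Otimes>\<^sub>M ?N) =
      S w \<times> A w \<union> S (\<not> w) \<times> A (\<not> w)" (is "?U = ?V")
  proof (intro set_eqI iffI)
    fix z assume "z \<in> ?U"
    then obtain x X where "z = (x, X)" "x \<in> space M" "X \<in> space ?N"
        "\<phi> (Suc k) (x, decision \<phi> k X) = v"
      by (auto simp: space_pair_measure space dec)
    then show "z \<in> ?V"
      by (cases "decision \<phi> k X = w") (auto simp: S_def A_def switch_set_def)
  next
    fix z assume "z \<in> ?V"
    then obtain x X where z: "z = (x, X)" "x \<in> space M" "X \<in> space ?N"
        "\<phi> (Suc k) (x, decision \<phi> k X) = v"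
      by (auto simp: S_def A_def switch_set_def)
    then show "z \<in> ?U"
      using measurable_space[OF upd, of z] by (simp add: space_pair_measure space dec)
  qed
  also have "measure (?L \<Otimes>\<^sub>M ?N) (S w \<times> A w \<union> S (\<not> w) \<times> A (\<not> w)) =
      measure (?L \<Otimes>\<^sub>M ?N) (S w \<times> A w) + measure (?L \<Otimes>\<^sub>M ?N) (S (\<not> w) \<times> A (\<not> w))"
    using A S by (intro LN.finite_measure_Union) (auto simp: A_def)
  also have "\<dots> = measure ?L (S w) * measure ?N (A w) + measure ?L (S (\<not> w)) * measure ?N (A (\<not> w))"
    unfolding Sigma_Algebra.measure_def N.emeasure_pair_measure_Times[OF S A] enn2real_mult ..
  finally show ?thesis
    by (simp add: S_def A_def state_prob_def mult.commute)
qed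

text \<open>Both terms of the recursion under \<open>P'\<close> are nonnegative, so a vanishing sum
  makes one factor of each vanish. Either factor then vanishes under \<open>P\<close> as well: the
  state probability by induction, the transition probability by absolute continuity.\<close>

lemma state_prob_eq_0_transfer:
  assumes \<phi>: "\<And>j. j \<ge> 1 \<Longrightarrow> \<phi> j \<in> decision_rules M"
    and P: "P \<in> space (prob_algebra M)" and P': "P' \<in> space (prob_algebra M)"
    and ac: "absolutely_continuous P' P"
    and "state_prob \<phi> (\<lambda>_. P') k u = 0"
  shows "state_prob \<phi> (\<lambda>_. P) k u = 0"
  using assms(5)
proof (induction k arbitrary: u)
  case 0
  have "PiM {1..0::nat} (\<lambda>_. P) = PiM {1..0::nat} (\<lambda>_. P')"
    by (rule PiM_cong) auto
  then show ?case using 0 by (simp add: state_prob_def)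
next
  case (Suc k)
  have null: "measure P B = 0" if "measure P' B = 0" "B \<in> sets M" for B
  proof -
    interpret P: prob_space P using P by (simp add: space_prob_algebra)
    interpret P': prob_space P' using P' by (simp add: space_prob_algebra)
    have "B \<in> null_sets P'"
      using that P' by (auto simp: null_sets_def P'.emeasure_eq_measure space_prob_algebra)
    then have "B \<in> null_sets P" using ac by (auto simp: absolutely_continuous_def)
    then show ?thesis by (simp add: measure_eq_0_null_sets)
  qed
  let ?S = "\<lambda>w. switch_set M \<phi> (Suc k) w u"
  have S: "?S w \<in> sets M" for w
    using \<phi>[of "Suc k"] by (intro switch_set_sets) auto
  have nonneg: "0 \<le> state_prob \<phi> (\<lambda>_. P') k w" for w
    by (simp add: state_prob_def)
  have "state_prob \<phi> (\<lambda>_. P') k w * measure P' (?S w) +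
      state_prob \<phi> (\<lambda>_. P') k (\<not> w) * measure P' (?S (\<not> w)) = 0" for w
    using state_prob_Suc[of \<phi> M "\<lambda>_. P'" k u w] \<phi> P' Suc.prems by simp
  then have "state_prob \<phi> (\<lambda>_. P') k w * measure P' (?S w) = 0" for w
    using nonneg by (metis add_nonneg_eq_0_iff measure_nonneg mult_nonneg_nonneg)
  then have "state_prob \<phi> (\<lambda>_. P) k w * measure P (?S w) = 0" for w
    using Suc.IH null S by (metis mult_eq_0_iff)
  note this[of u] this[of "\<not> u"]
  then show ?case
    using state_prob_Suc[of \<phi> M "\<lambda>_. P" k u u] \<phi> P by auto
qed

text \<open>If decision \<open>w\<close> is eventually never revised, its probability under \<open>P'\<close> is eventually
  nondecreasing, so it cannot vanish in the limit without being \<open>0\<close> at some stage; by absolute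
  continuity it is then \<open>0\<close> under \<open>P\<close> too.\<close>

lemma absorbing_decision_contradiction:
  assumes \<phi>: "\<And>j. j \<ge> 1 \<Longrightarrow> \<phi> j \<in> decision_rules M"
    and P: "P \<in> space (prob_algebra M)" and P': "P' \<in> space (prob_algebra M)"
    and ac: "absolutely_continuous P' P"
    and lim: "(\<lambda>k. state_prob \<phi> (\<lambda>_. P) k (\<not> w)) \<longlonglongrightarrow> 0"
      "(\<lambda>k. state_prob \<phi> (\<lambda>_. P') k w) \<longlonglongrightarrow> 0"
    and stay: "\<forall>\<^sub>F k in sequentially. measure P' (switch_set M \<phi> (Suc k) w (\<not> w)) = 0"
  shows False
proof -
  interpret P': prob_space P' using P' by (simp add: space_prob_algebra)
  let ?a = "state_prob \<phi> (\<lambda>_. P')"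
  \<comment> \<open>This is the fact contradicted at the end: if \<open>w\<close> has probability 0
    under \<open>P\<close> at stage \<open>K\<close>, then \<open>\<not> w\<close> has probability
    1.\<close>
  have "\<forall>\<^sub>F k in sequentially. state_prob \<phi> (\<lambda>_. P) k (\<not> w) < 1"
    using lim(1) by (rule order_tendstoD) simp
  from eventually_conj[OF this stay] obtain K where K: "\<And>k. k \<ge> K \<Longrightarrow> state_prob \<phi> (\<lambda>_. P) k (\<not> w) < 1"
      "\<And>k. k \<ge> K \<Longrightarrow> measure P' (switch_set M \<phi> (Suc k) w (\<not> w)) = 0"
    by (auto simp: eventually_sequentially)
  have step: "?a k w \<le> ?a (Suc k) w" if "k \<ge> K" for k
  proof -
    have "?a k w = ?a k w * 1" by simp
    also have "1 = measure P' (switch_set M \<phi> (Suc k) w w)"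
    proof -
      have "switch_set M \<phi> (Suc k) w w = space P' - switch_set M \<phi> (Suc k) w (\<not> w)"
        using prob_algebraD(2)[OF P'] by (auto simp: switch_set_def)
      then show ?thesis
        using K(2)[OF that] switch_set_sets[of \<phi> "Suc k" M] \<phi> prob_algebraD(1)[OF P']
        by (simp add: P'.prob_compl)
    qed
    also have "?a k w * \<dots> \<le> ?a (Suc k) w"
      using state_prob_Suc[of \<phi> M "\<lambda>_. P'" k w w] \<phi> P' by (simp add: state_prob_def)
    finally show ?thesis .
  qed
  have "?a K w \<le> ?a k w" if "k \<ge> K" for k
    using that by (induction k rule: dec_induct) (auto intro: order_trans step)
  then have "?a K w \<le> 0"
    using lim(2) by (intro LIMSEQ_le_const) auto
  then have "?a K w = 0"
    by (simp add: state_prob_def measure_le_0_iff)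
  then have "state_prob \<phi> (\<lambda>_. P) K w = 0"
    using state_prob_eq_0_transfer[of \<phi> M P P' K w] \<phi> P P' ac by simp
  then show False
    using K(1)[of K] state_prob_add[of \<phi> M "\<lambda>_. P" K w] \<phi> P by simp
qed

section \<open>Uncertainty classes and the worst-case risk\<close>

lemma nominal_in_uncertainty_class:
  assumes "P \<in> space (prob_algebra M)"
  shows "P \<in> uncertainty_class M P e"
  using assms by (auto simp: uncertainty_class_def algebra_simps intro!: bexI[of _ P])

lemma uncertainty_class_0:
  assumes P: "P \<in> space (prob_algebra M)"
  shows "uncertainty_class M P 0 = {P}"
proof -
  have "Q = P" if "Q \<in> uncertainty_class M P 0" for Q
  proof (rule measure_eqI)
    show "sets Q = sets P"
      using that P by (simp add: uncertainty_class_def space_prob_algebra)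
    fix B assume "B \<in> sets Q"
    moreover have "finite_measure Q" "finite_measure P"
      using that P by (auto simp: uncertainty_class_def space_prob_algebra prob_space_def)
    ultimately show "emeasure Q B = emeasure P B"
      using that by (simp add: uncertainty_class_def space_prob_algebra
          finite_measure.emeasure_eq_measure)
  qed
  then show ?thesis using nominal_in_uncertainty_class[OF P] by auto
qed

text \<open>The contaminating measure is the point mass at \<open>y\<close>. The mixture is built by
  tossing a coin of bias \<open>e\<close> and sampling from \<open>return M y\<close> or from
  \<open>P\<close>. The bound is stated for measurable sets containing \<open>y\<close> because
  \<open>{y}\<close> itself need not be measurable.\<close>

lemma dirac_contamination:
  assumes P: "P \<in> space (prob_algebra M)" and y: "y \<in> space M" and e: "0 \<le> e" "e \<le> 1"
  obtains Q where "Q \<in> uncertainty_class M P e"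
    "\<And>B. B \<in> sets M \<Longrightarrow> y \<in> B \<Longrightarrow> e \<le> measure Q B"
proof -
  let ?f = "\<lambda>b. if b then return M y else P"
  let ?Q = "measure_pmf (bernoulli_pmf e) \<bind> ?f"
  have ret: "return M y \<in> space (prob_algebra M)"
    using y by (simp add: space_prob_algebra prob_space_return)
  have f: "?f \<in> measurable (measure_pmf (bernoulli_pmf e)) (prob_algebra M)"
    using P ret by (auto simp: measurable_def)
  have b: "measure_pmf (bernoulli_pmf e) \<in> space (prob_algebra (count_space UNIV))"
    by (simp add: space_prob_algebra prob_space_measure_pmf)
  have f': "?f \<in> measurable (count_space UNIV) (prob_algebra M)"
    using P ret by auto
  have "?Q \<in> space (prob_algebra M)"
    using measurable_bind_prob_space[OF measurable_const[OF b] f', of "count_space UNIV"]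
    by (auto dest: measurable_space)
  moreover have meas: "measure ?Q B = (1 - e) * measure P B + e * measure (return M y) B"
    if "B \<in> sets M" for B
    using measure_pmf.measure_bind[OF measurable_prob_algebraD[OF f] that] e
    by (simp add: algebra_simps)
  ultimately have "?Q \<in> uncertainty_class M P e"
    using ret by (auto simp: uncertainty_class_def)
  moreover have "e \<le> measure ?Q B" if "B \<in> sets M" "y \<in> B" for B
    using meas[OF that(1)] that e by (simp add: measure_return)
  ultimately show ?thesis by (rule that)
qed

lemma error_prob_PiM:
  "error_prob \<pi>0 \<pi>1 \<phi> k (PiM {1..k} Q0) (PiM {1..k} Q1) =
     \<pi>0 * state_prob \<phi> Q0 k True + \<pi>1 * state_prob \<phi> Q1 k False"
  by (simp add: error_prob_def state_prob_def)

lemma error_prob_le_risk: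
  assumes "0 \<le> \<pi>0" "0 \<le> \<pi>1"
    and "\<And>j. j \<in> {1..k} \<Longrightarrow> Q0 j \<in> uncertainty_class M P0 (\<epsilon>0 j)"
    and "\<And>j. j \<in> {1..k} \<Longrightarrow> Q1 j \<in> uncertainty_class M P1 (\<epsilon>1 j)"
  shows "\<pi>0 * state_prob \<phi> Q0 k True + \<pi>1 * state_prob \<phi> Q1 k False
    \<le> social_learning_risk M P0 P1 \<epsilon>0 \<epsilon>1 \<pi>0 \<pi>1 k (\<phi> k) \<phi>"
proof -
  let ?F = "\<lambda>(\<mu>0, \<mu>1). error_prob \<pi>0 \<pi>1 (\<phi>(k := \<phi> k)) k \<mu>0 \<mu>1"
  let ?C = "product_class M P0 \<epsilon>0 k \<times> product_class M P1 \<epsilon>1 k"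
  \<comment> \<open>A real supremum dominates the members of its set only if the set is bounded
    above.\<close>
  have "?F z \<le> \<pi>0 + \<pi>1" if z: "z \<in> ?C" for z
  proof -
    obtain R0 R1 where R: "z = (PiM {1..k} R0, PiM {1..k} R1)"
      "\<And>j. j \<in> {1..k} \<Longrightarrow> R0 j \<in> uncertainty_class M P0 (\<epsilon>0 j)"
      "\<And>j. j \<in> {1..k} \<Longrightarrow> R1 j \<in> uncertainty_class M P1 (\<epsilon>1 j)"
      using z by (auto simp: product_class_def)
    have "state_prob \<phi> R0 k True \<le> 1" "state_prob \<phi> R1 k False \<le> 1"
      using R(2,3) by (auto intro!: state_prob_bounds simp: uncertainty_class_def space_prob_algebra)
    then have "\<pi>0 * state_prob \<phi> R0 k True + \<pi>1 * state_prob \<phi> R1 k False \<le> \<pi>0 * 1 + \<pi>1 * 1"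
      using assms(1,2) by (intro add_mono mult_left_mono) auto
    then show ?thesis by (simp only: R(1) error_prob_PiM fun_upd_triv prod.case mult_1_right)
  qed
  then have "bdd_above (?F ` ?C)" by (rule bdd_aboveI2)
  moreover have "(PiM {1..k} Q0, PiM {1..k} Q1) \<in> ?C"
    using assms(3,4) by (auto simp: product_class_def)
  ultimately have "?F (PiM {1..k} Q0, PiM {1..k} Q1) \<le> (SUP z\<in>?C. ?F z)"
    by (rule cSUP_upper2) simp_all
  then show ?thesis
    by (simp only: social_learning_risk_def error_prob_PiM fun_upd_triv prod.case)
qed

text \<open>Without contamination each class is a singleton, so the supremum runs over a single pair
  of product laws.\<close>

lemma risk_uncontaminated:
  assumes P: "P0 \<in> space (prob_algebra M)" "P1 \<in> space (prob_algebra M)"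
    and e: "\<And>j. j \<ge> 1 \<Longrightarrow> \<epsilon>0 j = 0" "\<And>j. j \<ge> 1 \<Longrightarrow> \<epsilon>1 j = 0"
  shows "social_learning_risk M P0 P1 \<epsilon>0 \<epsilon>1 \<pi>0 \<pi>1 k \<psi> \<phi> =
    \<pi>0 * state_prob (\<phi>(k := \<psi>)) (\<lambda>_. P0) k True + \<pi>1 * state_prob (\<phi>(k := \<psi>)) (\<lambda>_. P1) k False"
proof -
  have singleton: "product_class M P \<epsilon> k = {PiM {1..k} (\<lambda>_. P)}"
    if "P \<in> space (prob_algebra M)" "\<And>j. j \<ge> 1 \<Longrightarrow> \<epsilon> j = 0" for P and \<epsilon> :: "nat \<Rightarrow> real"
  proof -
    have "PiM {1..k} Q = PiM {1..k} (\<lambda>_. P)"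
      if "\<forall>j\<in>{1..k}. Q j \<in> uncertainty_class M P (\<epsilon> j)" for Q
      using that uncertainty_class_0[OF \<open>P \<in> space (prob_algebra M)\<close>]
        \<open>\<And>j. j \<ge> 1 \<Longrightarrow> \<epsilon> j = 0\<close>
      by (intro PiM_cong) auto
    then show ?thesis
      using nominal_in_uncertainty_class[OF that(1)] unfolding product_class_def by blast
  qed
  have "product_class M P0 \<epsilon>0 k = {PiM {1..k} (\<lambda>_. P0)}" "product_class M P1 \<epsilon>1 k = {PiM {1..k} (\<lambda>_. P1)}"
    using P e by (intro singleton; simp)+
  then show ?thesis
    by (simp del: One_nat_def add: social_learning_risk_def error_prob_PiM)
qed

section \<open>Contamination prevents learning\<close>

text \<open>Here \<open>w\<close> is the right decision under \<open>P\<close> and the wrong one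
  under \<open>P'\<close>, and \<open>\<rho>\<close> bounds the error over all contaminations of
  \<open>P\<close>. If at a late stage some observation led from \<open>w\<close> to
  \<open>\<not> w\<close>, placing mass \<open>e\<close> on it would force an error above this
  bound. Hence \<open>w\<close> becomes absorbing.\<close>

lemma contamination_contradiction:
  assumes \<phi>: "\<And>j. j \<ge> 1 \<Longrightarrow> \<phi> j \<in> decision_rules M"
    and P: "P \<in> space (prob_algebra M)" and P': "P' \<in> space (prob_algebra M)"
    and ac: "absolutely_continuous P' P"
    and e: "0 < e" "e \<le> 1" and \<rho>: "\<rho> \<longlonglongrightarrow> 0"
    and wrong: "\<And>k Q. (\<And>j. Q j \<in> uncertainty_class M P e) \<Longrightarrow> state_prob \<phi> Q k (\<not> w) \<le> \<rho> k"
    and lim: "(\<lambda>k. state_prob \<phi> (\<lambda>_. P') k w) \<longlonglongrightarrow> 0"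
  shows False
proof (rule absorbing_decision_contradiction[OF \<phi> P P' ac _ lim])
  note nom = nominal_in_uncertainty_class[OF P]
  show lim0: "(\<lambda>k. state_prob \<phi> (\<lambda>_. P) k (\<not> w)) \<longlonglongrightarrow> 0"
    using wrong[of "\<lambda>_. P"] nom
    by (intro tendsto_sandwich[OF _ _ tendsto_const \<rho>]) (auto simp: state_prob_def)
  \<comment> \<open>The bound at \<open>k\<close> leaves \<open>w\<close> with probability at least
    1/2, because \<open>e \<le> 1\<close>. A switch of mass \<open>e\<close> then produces error at
    least \<open>e / 2\<close>, which the bound at \<open>Suc k\<close> excludes.\<close>
  have "\<forall>\<^sub>F k in sequentially. \<rho> k < e / 2 \<and> \<rho> (Suc k) < e / 2"
    using \<rho> LIMSEQ_Suc[OF \<rho>] e by (intro eventually_conj order_tendstoD[of _ 0]) auto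
  then show "\<forall>\<^sub>F k in sequentially. measure P' (switch_set M \<phi> (Suc k) w (\<not> w)) = 0"
  proof (rule eventually_mono)
    fix k assume small: "\<rho> k < e / 2 \<and> \<rho> (Suc k) < e / 2"
    let ?S = "switch_set M \<phi> (Suc k) w (\<not> w)"
    have "?S = {}"
    proof (rule ccontr)
      assume "?S \<noteq> {}"
      then obtain y where y: "y \<in> ?S" "y \<in> space M" by (auto simp: switch_set_def)
      obtain R where R: "R \<in> uncertainty_class M P e"
          "\<And>B. B \<in> sets M \<Longrightarrow> y \<in> B \<Longrightarrow> e \<le> measure R B"
        using dirac_contamination[OF P y(2), of e] e by auto
      \<comment> \<open>Only agent \<open>Suc k\<close> is contaminated, so the law of the first
        \<open>k\<close> decisions remains nominal.\<close>
      define Q where "Q = (\<lambda>_. P)(Suc k := R)"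
      have Q: "Q j \<in> uncertainty_class M P e" for j
        using R(1) nom by (simp add: Q_def)
      then have Qp: "Q j \<in> space (prob_algebra M)" for j
        by (simp add: uncertainty_class_def)
      have "PiM {1..k} Q = PiM {1..k} (\<lambda>_. P)"
        by (rule PiM_cong) (auto simp: Q_def)
      then have "state_prob \<phi> Q k w = 1 - state_prob \<phi> (\<lambda>_. P) k (\<not> w)"
        using state_prob_add[of \<phi> M "\<lambda>_. P" k w] \<phi> P by (simp add: state_prob_def)
      also have "\<dots> \<ge> 1 - \<rho> k" using wrong[of "\<lambda>_. P" k] nom by simp
      finally have "1 / 2 \<le> state_prob \<phi> Q k w" using small e by simp
      moreover have "e \<le> measure (Q (Suc k)) ?S"
        using R(2) y(1) \<phi> by (simp add: Q_def switch_set_sets)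
      ultimately have "1 / 2 * e \<le> state_prob \<phi> Q k w * measure (Q (Suc k)) ?S"
        using e by (intro mult_mono) auto
      also have "\<dots> \<le> state_prob \<phi> Q (Suc k) (\<not> w)"
        using state_prob_Suc[of \<phi> M Q k "\<not> w" w] \<phi> Qp by (simp add: state_prob_def)
      also have "\<dots> \<le> \<rho> (Suc k)" by (rule wrong[OF Q])
      finally show False using small by simp
    qed
    then show "measure P' ?S = 0" by simp
  qed
qed

section \<open>Competing rules that modify the response to one predecessor decision\<close>

text \<open>Two instances matter: with \<open>S = {}\<close> the decision \<open>w\<close> is never
  left, and with \<open>f\<close> the rule copying its predecessor, decisions change only from
  \<open>w\<close> and only on \<open>S\<close>.\<close>

definition override :: "bool \<Rightarrow> 'y set \<Rightarrow> ('y \<times> bool \<Rightarrow> bool) \<Rightarrow> 'y \<times> bool \<Rightarrow> bool" where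
  "override w S f = (\<lambda>(y, u). if u = w then (if y \<in> S then \<not> w else w) else f (y, u))"

lemma override_in_decision_rules:
  assumes [measurable]: "S \<in> sets M" and "f \<in> decision_rules M"
  shows "override w S f \<in> decision_rules M"
proof -
  have [measurable]: "f \<in> measurable (M \<Otimes>\<^sub>M count_space UNIV) (count_space UNIV)"
    using assms by (simp add: decision_rules_def)
  have "(\<lambda>x. if snd x = w then (if fst x \<in> S then \<not> w else w) else f x)
      \<in> measurable (M \<Otimes>\<^sub>M count_space UNIV) (count_space UNIV)"
    by measurable
  then show ?thesis by (simp add: override_def decision_rules_def case_prod_unfold)
qed

lemma state_prob_override:
  assumes \<phi>: "\<And>j. j \<ge> 1 \<Longrightarrow> \<phi> j \<in> decision_rules M"
    and P: "P \<in> space (prob_algebra M)" and S: "S \<in> sets M" and f: "f \<in> decision_rules M"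
  shows "state_prob (\<phi>(Suc k := override w S f)) (\<lambda>_. P) (Suc k) (\<not> w) =
    state_prob \<phi> (\<lambda>_. P) k w * measure P S +
    state_prob \<phi> (\<lambda>_. P) k (\<not> w) * measure P {y \<in> space M. f (y, \<not> w) = (\<not> w)}"
proof -
  let ?\<phi> = "\<phi>(Suc k := override w S f)"
  have rules: "?\<phi> j \<in> decision_rules M" if "j \<ge> 1" for j
    using that \<phi> override_in_decision_rules[OF S f] by simp
  have "decision ?\<phi> k y = decision \<phi> k y" for y
    by (rule decision_cong) auto
  then have "state_prob ?\<phi> (\<lambda>_. P) k u = state_prob \<phi> (\<lambda>_. P) k u" for u
    by (simp add: state_prob_def)
  moreover have "switch_set M ?\<phi> (Suc k) w (\<not> w) = S"
    using sets.sets_into_space[OF S] by (auto simp: switch_set_def override_def)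
  moreover have "switch_set M ?\<phi> (Suc k) (\<not> w) (\<not> w) = {y \<in> space M. f (y, \<not> w) = (\<not> w)}"
    by (auto simp: switch_set_def override_def)
  ultimately show ?thesis
    using state_prob_Suc[of ?\<phi> M "\<lambda>_. P" k "\<not> w" w] rules P by simp
qed

text \<open>Again \<open>w\<close> is right under \<open>P\<close>. The optimal rule is compared
  with the one that never leaves \<open>w\<close>. Leaving \<open>w\<close> costs error under
  \<open>P\<close>, where \<open>w\<close> is nearly certain, and saves error under
  \<open>P'\<close>, where \<open>w\<close> is rare. As the ratio is at most \<open>C\<close>, the
  saving eventually cannot pay for the cost unless leaving has probability 0.\<close>

lemma bounded_ratio_contradiction:
  assumes \<phi>: "\<And>j. j \<ge> 1 \<Longrightarrow> \<phi> j \<in> decision_rules M"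
    and P: "P \<in> space (prob_algebra M)" and P': "P' \<in> space (prob_algebra M)"
    and ac: "absolutely_continuous P' P"
    and prior: "0 < \<pi>" "0 < \<pi>'"
    and C: "\<And>S. S \<in> sets M \<Longrightarrow> measure P' S \<le> C * measure P S"
    and lim: "(\<lambda>k. state_prob \<phi> (\<lambda>_. P) k (\<not> w)) \<longlonglongrightarrow> 0"
      "(\<lambda>k. state_prob \<phi> (\<lambda>_. P') k w) \<longlonglongrightarrow> 0"
    and minimal: "\<And>k \<psi>. \<psi> \<in> decision_rules M \<Longrightarrow>
      \<pi> * state_prob \<phi> (\<lambda>_. P) (Suc k) (\<not> w) + \<pi>' * state_prob \<phi> (\<lambda>_. P') (Suc k) w \<le>
      \<pi> * state_prob (\<phi>(Suc k := \<psi>)) (\<lambda>_. P) (Suc k) (\<not> w) +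
      \<pi>' * state_prob (\<phi>(Suc k := \<psi>)) (\<lambda>_. P') (Suc k) w"
  shows False
proof (rule absorbing_decision_contradiction[OF \<phi> P P' ac lim])
  \<comment> \<open>This is the bound on saving minus cost per unit of \<open>P\<close>-mass of the
    switching set; its limit is \<open>- \<pi>\<close>.\<close>
  have "(\<lambda>k. \<pi>' * C * state_prob \<phi> (\<lambda>_. P') k w - \<pi> * (1 - state_prob \<phi> (\<lambda>_. P) k (\<not> w)))
      \<longlonglongrightarrow> \<pi>' * C * 0 - \<pi> * (1 - 0)"
    by (intro tendsto_intros lim)
  then have "\<forall>\<^sub>F k in sequentially.
      \<pi>' * C * state_prob \<phi> (\<lambda>_. P') k w - \<pi> * (1 - state_prob \<phi> (\<lambda>_. P) k (\<not> w)) < 0"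
    using prior by (intro order_tendstoD) auto
  then show "\<forall>\<^sub>F k in sequentially. measure P' (switch_set M \<phi> (Suc k) w (\<not> w)) = 0"
  proof (rule eventually_mono)
    fix k
    let ?a = "state_prob \<phi> (\<lambda>_. P)" and ?b = "state_prob \<phi> (\<lambda>_. P')"
    let ?S = "switch_set M \<phi> (Suc k) w (\<not> w)" and ?\<psi> = "override w {} (\<phi> (Suc k))"
    let ?T = "switch_set M \<phi> (Suc k) (\<not> w) (\<not> w)"
    assume small: "\<pi>' * C * ?b k w - \<pi> * (1 - ?a k (\<not> w)) < 0"
    have rule: "\<phi> (Suc k) \<in> decision_rules M" using \<phi> by simp
    have S: "?S \<in> sets M" using rule by (rule switch_set_sets)
    have \<psi>: "?\<psi> \<in> decision_rules M" by (rule override_in_decision_rules[OF _ rule]) simp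
    then have rules: "(\<phi>(Suc k := ?\<psi>)) j \<in> decision_rules M" if "j \<ge> 1" for j
      using that \<phi> by simp
    \<comment> \<open>The two rules agree after \<open>\<not> w\<close>, so only the flow out of
      \<open>w\<close> distinguishes them.\<close>
    have gain: "state_prob \<phi> (\<lambda>_. R) (Suc k) (\<not> w) =
        state_prob (\<phi>(Suc k := ?\<psi>)) (\<lambda>_. R) (Suc k) (\<not> w) + state_prob \<phi> (\<lambda>_. R) k w * measure R ?S"
      if "R \<in> space (prob_algebra M)" for R
      using state_prob_Suc[of \<phi> M "\<lambda>_. R" k "\<not> w" w] state_prob_override[of \<phi> M R "{}" "\<phi> (Suc k)" k w]
        \<phi> that rule by (simp add: switch_set_def)
    have "?b (Suc k) w = state_prob (\<phi>(Suc k := ?\<psi>)) (\<lambda>_. P') (Suc k) w - ?b k w * measure P' ?S"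
      using gain[OF P'] state_prob_add[of \<phi> M "\<lambda>_. P'" "Suc k" w]
        state_prob_add[of "\<phi>(Suc k := ?\<psi>)" M "\<lambda>_. P'" "Suc k" w] \<phi> rules P'
      by simp
    then have "\<pi>' * ?b (Suc k) w = \<pi>' * state_prob (\<phi>(Suc k := ?\<psi>)) (\<lambda>_. P') (Suc k) w -
        \<pi>' * (?b k w * measure P' ?S)"
      by (simp add: right_diff_distrib)
    \<comment> \<open>Optimality: the cost of switching is at most its saving.\<close>
    then have "\<pi> * (?a k w * measure P ?S) \<le> \<pi>' * (?b k w * measure P' ?S)"
      using minimal[OF \<psi>, of k] unfolding gain[OF P] distrib_left by linarith
    also have "\<dots> \<le> \<pi>' * (?b k w * (C * measure P ?S))"
      using prior C[OF S] by (intro mult_left_mono) (auto simp: state_prob_def)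
    finally have "0 \<le> (\<pi>' * C * ?b k w - \<pi> * ?a k w) * measure P ?S"
      by (simp add: algebra_simps)
    moreover have "?a k w = 1 - ?a k (\<not> w)"
      using state_prob_add[of \<phi> M "\<lambda>_. P" k w] \<phi> P by simp
    ultimately have "measure P ?S = 0"
      using small by (metis measure_nonneg mult_neg_pos not_le order_le_less)
    then show "measure P' ?S = 0"
      using C[OF S] by (simp add: measure_le_0_iff)
  qed
qed

text \<open>In contrast to the preceding lemma, \<open>w\<close> is now the wrong decision under
  \<open>P\<close>, with error share at least \<open>R / 2\<close>. Copying the predecessor but
  reversing \<open>w\<close> on \<open>S\<close> removes at least \<open>R / 2 * measure P S\<close>
  of this error and adds at most \<open>measure P' S\<close>, that is, at most half as much.\<close>

lemma override_improvement:
  assumes \<phi>: "\<And>j. j \<ge> 1 \<Longrightarrow> \<phi> j \<in> decision_rules M"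
    and P: "P \<in> space (prob_algebra M)" and P': "P' \<in> space (prob_algebra M)"
    and prior: "0 \<le> \<pi>" "0 \<le> \<pi>'" "\<pi>' \<le> 1"
    and S: "S \<in> sets M" "measure P' S \<le> R / 4 * measure P S"
    and R: "0 < R" "R / 2 \<le> \<pi> * state_prob \<phi> (\<lambda>_. P) k w"
  obtains \<psi> where "\<psi> \<in> decision_rules M"
    "\<pi> * state_prob (\<phi>(Suc k := \<psi>)) (\<lambda>_. P) (Suc k) w +
     \<pi>' * state_prob (\<phi>(Suc k := \<psi>)) (\<lambda>_. P') (Suc k) (\<not> w) \<le>
     \<pi> * state_prob \<phi> (\<lambda>_. P) k w + \<pi>' * state_prob \<phi> (\<lambda>_. P') k (\<not> w) - R / 4 * measure P S"
proof -
  let ?f = "\<lambda>(_, u). u"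
  let ?\<psi> = "override w S ?f"
  let ?a = "state_prob \<phi> (\<lambda>_. P)" and ?b = "state_prob \<phi> (\<lambda>_. P')"
  have f: "?f \<in> decision_rules M" by (simp add: decision_rules_def)
  have \<psi>: "?\<psi> \<in> decision_rules M" by (rule override_in_decision_rules[OF S(1) f])
  then have rules: "(\<phi>(Suc k := ?\<psi>)) j \<in> decision_rules M" if "j \<ge> 1" for j
    using that \<phi> by simp
  have eq: "state_prob (\<phi>(Suc k := ?\<psi>)) (\<lambda>_. Q) (Suc k) (\<not> w) =
      state_prob \<phi> (\<lambda>_. Q) k w * measure Q S + state_prob \<phi> (\<lambda>_. Q) k (\<not> w)"
    if Q: "Q \<in> space (prob_algebra M)" for Q
  proof -
    have "measure Q (space M) = 1"
      using prob_space.prob_space[of Q] prob_algebraD[OF Q] by simp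
    then show ?thesis using state_prob_override[of \<phi> M Q S ?f k w] \<phi> Q S(1) f by simp
  qed
  have a: "state_prob (\<phi>(Suc k := ?\<psi>)) (\<lambda>_. P) (Suc k) w = ?a k w - ?a k w * measure P S"
    using eq[OF P] state_prob_add[of \<phi> M "\<lambda>_. P" k w]
      state_prob_add[of "\<phi>(Suc k := ?\<psi>)" M "\<lambda>_. P" "Suc k" w] \<phi> rules P
    by simp
  have "\<pi>' * (?b k w * measure P' S) \<le> 1 * (1 * measure P' S)"
    using prior P' by (intro mult_mono state_prob_bounds) (auto simp: state_prob_def space_prob_algebra)
  moreover have "R / 2 * measure P S \<le> \<pi> * ?a k w * measure P S"
    using R by (intro mult_right_mono) auto
  ultimately have "\<pi> * state_prob (\<phi>(Suc k := ?\<psi>)) (\<lambda>_. P) (Suc k) w +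
     \<pi>' * state_prob (\<phi>(Suc k := ?\<psi>)) (\<lambda>_. P') (Suc k) (\<not> w) \<le>
     \<pi> * ?a k w + \<pi>' * ?b k (\<not> w) - R / 4 * measure P S"
    using S(2) unfolding a eq[OF P'] by (simp add: algebra_simps)
  with \<psi> show ?thesis by (rule that)
qed

section \<open>Density ratios and inequalities between measures\<close>

lemma density_measure_le:
  assumes \<nu>: "sets \<nu> = sets M"
    and p: "p \<in> borel_measurable M" and p': "p' \<in> borel_measurable M"
    and P: "P = density \<nu> (\<lambda>y. ennreal (p y))" "prob_space P"
    and P': "P' = density \<nu> (\<lambda>y. ennreal (p' y))" "prob_space P'"
    and C: "0 \<le> C" and S: "S \<in> sets M" and le: "AE y in P'. y \<in> S \<longrightarrow> p' y \<le> C * p y"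
  shows "measure P' S \<le> C * measure P S"
proof -
  interpret P: prob_space P by (rule P)
  interpret P': prob_space P' by (rule P')
  have [measurable]: "p \<in> borel_measurable \<nu>" "p' \<in> borel_measurable \<nu>" "S \<in> sets \<nu>"
    using p p' S \<nu> by (simp_all cong: measurable_cong_sets)
  have "AE y in \<nu>. 0 < ennreal (p' y) \<longrightarrow> y \<in> S \<longrightarrow> p' y \<le> C * p y"
    using le unfolding P'(1) by (subst (asm) AE_density) auto
  then have "AE y in \<nu>. ennreal (p' y) * indicator S y \<le> ennreal C * (ennreal (p y) * indicator S y)"
  proof (rule AE_mp, intro AE_I2 impI)
    fix y assume "0 < ennreal (p' y) \<longrightarrow> y \<in> S \<longrightarrow> p' y \<le> C * p y"
    then show "ennreal (p' y) * indicator S y \<le> ennreal C * (ennreal (p y) * indicator S y)"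
      \<comment> \<open>The hypothesis speaks only where \<open>p'\<close> is positive; elsewhere
        \<open>ennreal\<close> truncates the left side to 0.\<close>
      using C by (cases "p' y \<le> 0")
        (auto split: split_indicator simp: ennreal_neg ennreal_mult'[symmetric] intro!: ennreal_leI)
  qed
  then have "(\<integral>\<^sup>+y. ennreal (p' y) * indicator S y \<partial>\<nu>) \<le>
      (\<integral>\<^sup>+y. ennreal C * (ennreal (p y) * indicator S y) \<partial>\<nu>)"
    by (rule nn_integral_mono_AE)
  also have "\<dots> = ennreal C * (\<integral>\<^sup>+y. ennreal (p y) * indicator S y \<partial>\<nu>)"
    by (rule nn_integral_cmult) measurable
  finally have "emeasure P' S \<le> ennreal C * emeasure P S"
    unfolding P(1) P'(1) by (simp add: emeasure_density)
  then show ?thesis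
    using C by (simp add: P.emeasure_eq_measure P'.emeasure_eq_measure ennreal_mult'[symmetric])
qed

lemma bounded_density_ratio:
  assumes \<nu>: "sets \<nu> = sets M"
    and p: "p \<in> borel_measurable M" "\<And>y. y \<in> space M \<Longrightarrow> 0 \<le> p y"
    and p': "p' \<in> borel_measurable M"
    and P: "P = density \<nu> (\<lambda>y. ennreal (p y))" "prob_space P"
    and P': "P' = density \<nu> (\<lambda>y. ennreal (p' y))" "prob_space P'"
    and bound: "AE y in P'. p' y \<le> C * p y"
  obtains D where "\<And>S. S \<in> sets M \<Longrightarrow> measure P' S \<le> D * measure P S"
proof -
  have "space P' = space M"
    unfolding P'(1) space_density by (rule sets_eq_imp_space_eq[OF \<nu>])
  \<comment> \<open>The constant must be nonnegative to pass to \<open>ennreal\<close>; enlarging it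
    is harmless because \<open>p\<close> is nonnegative.\<close>
  have "AE y in P'. p' y \<le> max C 0 * p y"
    using bound
  proof (rule AE_mp, intro AE_I2 impI)
    fix y assume "y \<in> space P'" and le: "p' y \<le> C * p y"
    then have "0 \<le> p y"
      using p(2) \<open>space P' = space M\<close> by simp
    then show "p' y \<le> max C 0 * p y"
      using le by (meson max.cobounded1 mult_right_mono order_trans)
  qed
  then have "measure P' S \<le> max C 0 * measure P S" if "S \<in> sets M" for S
    using that by (intro density_measure_le[OF \<nu> p(1) p' P P']) auto
  then show ?thesis by (rule that)
qed

text \<open>The set is where \<open>p' \<le> c * p\<close>. Were it \<open>P\<close>-null,
  \<open>p\<close> would be at most \<open>inverse c * p'\<close> almost everywhere, against
  unboundedness.\<close>

lemma unbounded_density_ratio: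
  assumes \<nu>: "sets \<nu> = sets M"
    and p: "p \<in> borel_measurable M" and p': "p' \<in> borel_measurable M"
    and P: "P = density \<nu> (\<lambda>y. ennreal (p y))" "prob_space P"
    and P': "P' = density \<nu> (\<lambda>y. ennreal (p' y))" "prob_space P'"
    and unbounded: "\<nexists>C. AE y in P. p y \<le> C * p' y" and c: "0 < c"
  obtains S where "S \<in> sets M" "0 < measure P S" "measure P' S \<le> c * measure P S"
proof -
  interpret P: prob_space P by (rule P)
  have sets: "sets P = sets M" using \<nu> by (simp add: P(1))
  have space: "space P = space M" by (rule sets_eq_imp_space_eq[OF sets])
  note [measurable] = p p'
  define S where "S = {y \<in> space M. p' y \<le> c * p y}"
  have S: "S \<in> sets M" unfolding S_def by measurable
  have "measure P S \<noteq> 0"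
  proof
    assume "measure P S = 0"
    then have "AE y in P. y \<notin> S"
      using S sets by (intro AE_not_in) (auto simp: null_sets_def P.emeasure_eq_measure)
    then have "AE y in P. p y \<le> inverse c * p' y"
      by (rule AE_mp, intro AE_I2 impI)
        (use c space in \<open>auto simp: S_def field_simps\<close>)
    then show False using unbounded by blast
  qed
  then have "0 < measure P S" by (simp add: zero_less_measure_iff)
  moreover have "measure P' S \<le> c * measure P S"
    using c by (intro density_measure_le[OF \<nu> p p' P P' _ S]) (auto simp: S_def)
  ultimately show ?thesis by (rule that[OF S])
qed

lemma AE_density_pos:
  assumes "sets \<nu> = sets M" "p \<in> borel_measurable M" "P = density \<nu> (\<lambda>y. ennreal (p y))"
  shows "AE y in P. 0 < p y"
proof -
  have [measurable]: "p \<in> borel_measurable \<nu>"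
    using assms by (simp cong: measurable_cong_sets)
  show ?thesis unfolding assms(3) by (subst AE_density) auto
qed

text \<open>Exponentiating turns the two one-sided bounds on the logarithm into multiplicative
  bounds that are symmetric in the two densities.\<close>

lemma ess_unbounded_log_likelihood_ratio_iff:
  assumes pos: "AE y in P. 0 < p0 y" "AE y in P. 0 < p1 y"
  shows "ess_unbounded P (log_likelihood_ratio p1 p0) \<longleftrightarrow>
    (\<nexists>C. AE y in P. p1 y \<le> C * p0 y) \<and> (\<nexists>C. AE y in P. p0 y \<le> C * p1 y)"
proof -
  have "(\<exists>c. AE y in P. log_likelihood_ratio p1 p0 y \<le> c) \<longleftrightarrow> (\<exists>C. AE y in P. p1 y \<le> C * p0 y)"
  proof (intro iffI; elim exE)
    fix c assume "AE y in P. log_likelihood_ratio p1 p0 y \<le> c"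
    with pos have "AE y in P. p1 y \<le> exp c * p0 y"
    proof eventually_elim
      case (elim y)
      then have "p1 y / p0 y \<le> exp c"
        by (metis log_likelihood_ratio_def divide_pos_pos exp_le_cancel_iff exp_ln)
      with elim show ?case by (simp add: field_simps)
    qed
    then show "\<exists>C. AE y in P. p1 y \<le> C * p0 y" ..
  next
    fix C assume "AE y in P. p1 y \<le> C * p0 y"
    with pos have "AE y in P. log_likelihood_ratio p1 p0 y \<le> ln C"
    proof eventually_elim
      case (elim y)
      \<comment> \<open>A positive ratio below \<open>C\<close> makes \<open>C\<close> positive, so
        \<open>ln\<close> is monotone here and its default values do not interfere.\<close>
      then have "p1 y / p0 y \<le> C" "0 < p1 y / p0 y" by (simp_all add: field_simps)
      then show ?case by (simp add: log_likelihood_ratio_def)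
    qed
    then show "\<exists>c. AE y in P. log_likelihood_ratio p1 p0 y \<le> c" ..
  qed
  moreover have "(\<exists>c. AE y in P. c \<le> log_likelihood_ratio p1 p0 y) \<longleftrightarrow> (\<exists>C. AE y in P. p0 y \<le> C * p1 y)"
  proof (intro iffI; elim exE)
    fix c assume "AE y in P. c \<le> log_likelihood_ratio p1 p0 y"
    with pos have "AE y in P. p0 y \<le> exp (- c) * p1 y"
    proof eventually_elim
      case (elim y)
      then have "exp c \<le> p1 y / p0 y"
        by (simp add: log_likelihood_ratio_def ln_ge_iff)
      with elim show ?case by (simp add: field_simps exp_minus)
    qed
    then show "\<exists>C. AE y in P. p0 y \<le> C * p1 y" ..
  next
    fix C assume "AE y in P. p0 y \<le> C * p1 y"
    with pos have "AE y in P. - ln C \<le> log_likelihood_ratio p1 p0 y"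
    proof eventually_elim
      case (elim y)
      then have "p0 y / p1 y \<le> C" "0 < p0 y / p1 y" by (simp_all add: field_simps)
      then have "ln (p0 y / p1 y) \<le> ln C" by simp
      with elim show ?case by (simp add: log_likelihood_ratio_def ln_div)
    qed
    then show "\<exists>c. AE y in P. c \<le> log_likelihood_ratio p1 p0 y" ..
  qed
  ultimately show ?thesis by (simp add: ess_unbounded_def)
qed

section \<open>Both directions of the equivalence\<close>

theorem theorem4:
  fixes M \<nu> P0 P1 :: "'y measure"
    and p0 p1 :: "'y \<Rightarrow> real"
    and \<epsilon>0 \<epsilon>1 :: "nat \<Rightarrow> real"
    and e0 e1 \<pi>0 \<pi>1 :: real
    and \<phi> :: "nat \<Rightarrow> 'y \<times> bool \<Rightarrow> bool"
  assumes priors: "0 < \<pi>0" "\<pi>0 < 1" "0 < \<pi>1" "\<pi>1 < 1" "\<pi>0 + \<pi>1 = 1"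
    and nominal: "P0 \<in> space (prob_algebra M)" "P1 \<in> space (prob_algebra M)"
    and contamination: "\<And>k. k \<ge> 1 \<Longrightarrow> \<epsilon>0 k \<in> {0..<1}" "\<And>k. k \<ge> 1 \<Longrightarrow> \<epsilon>1 k \<in> {0..<1}"
    and classes_disjoint: "\<And>k. k \<ge> 1 \<Longrightarrow>
          uncertainty_class M P0 (\<epsilon>0 k) \<inter> uncertainty_class M P1 (\<epsilon>1 k) = {}"
    and mutually_ac: "\<And>k Q Q'. k \<ge> 1 \<Longrightarrow>
          Q \<in> uncertainty_class M P0 (\<epsilon>0 k) \<union> uncertainty_class M P1 (\<epsilon>1 k) \<Longrightarrow>
          Q' \<in> uncertainty_class M P0 (\<epsilon>0 k) \<union> uncertainty_class M P1 (\<epsilon>1 k) \<Longrightarrow>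
          absolutely_continuous Q Q'"
    and common_measure: "sets \<nu> = sets M"
    and density0: "p0 \<in> borel_measurable M" "\<And>y. y \<in> space M \<Longrightarrow> 0 \<le> p0 y"
          "P0 = density \<nu> (\<lambda>y. ennreal (p0 y))"
    and density1: "p1 \<in> borel_measurable M" "\<And>y. y \<in> space M \<Longrightarrow> 0 \<le> p1 y"
          "P1 = density \<nu> (\<lambda>y. ennreal (p1 y))"
    and identical: "\<And>k. k \<ge> 1 \<Longrightarrow> \<epsilon>0 k = e0" "\<And>k. k \<ge> 1 \<Longrightarrow> \<epsilon>1 k = e1"
    and rules: "\<And>k. k \<ge> 1 \<Longrightarrow> \<phi> k \<in> decision_rules M"
    and minimizing: "\<And>k \<psi>. k \<ge> 1 \<Longrightarrow> \<psi> \<in> decision_rules M \<Longrightarrow>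
          social_learning_risk M P0 P1 \<epsilon>0 \<epsilon>1 \<pi>0 \<pi>1 k (\<phi> k) \<phi>
            \<le> social_learning_risk M P0 P1 \<epsilon>0 \<epsilon>1 \<pi>0 \<pi>1 k \<psi> \<phi>"
  shows "(\<lambda>k. social_learning_risk M P0 P1 \<epsilon>0 \<epsilon>1 \<pi>0 \<pi>1 k (\<phi> k) \<phi>) \<longlonglongrightarrow> 0 \<longleftrightarrow>
         e0 = 0 \<and> e1 = 0 \<and> ess_unbounded P0 (log_likelihood_ratio p1 p0)"
proof -
  let ?risk = "\<lambda>k. social_learning_risk M P0 P1 \<epsilon>0 \<epsilon>1 \<pi>0 \<pi>1 k (\<phi> k) \<phi>"
  let ?a = "state_prob \<phi> (\<lambda>_. P0)" and ?b = "state_prob \<phi> (\<lambda>_. P1)"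
  have prob: "prob_space P0" "prob_space P1" and sets: "sets P0 = sets M" "sets P1 = sets M"
    using nominal by (auto simp: space_prob_algebra)
  have e: "0 \<le> e0" "e0 \<le> 1" "0 \<le> e1" "e1 \<le> 1"
    using contamination[of 1] identical[of 1] by auto
  note nom = nominal_in_uncertainty_class[OF nominal(1)] nominal_in_uncertainty_class[OF nominal(2)]
  have ac: "absolutely_continuous P0 P1" "absolutely_continuous P1 P0"
    using mutually_ac[of 1] nom by blast+
  have pos0: "AE y in P0. 0 < p0 y"
    by (rule AE_density_pos[OF common_measure density0(1,3)])
  have pos1: "AE y in P1. 0 < p1 y"
    by (rule AE_density_pos[OF common_measure density1(1,3)])
  \<comment> \<open>The ratio lemmas need almost-everywhere statements under different nominal
    measures; mutual absolute continuity lets them be exchanged.\<close>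
  have AE_iff: "(AE y in P0. \<Phi> y) \<longleftrightarrow> (AE y in P1. \<Phi> y)" for \<Phi>
    using absolutely_continuous_AE[OF _ ac(1), of \<Phi>] absolutely_continuous_AE[OF _ ac(2), of \<Phi>] sets
    by auto
  note unbounded_iff = ess_unbounded_log_likelihood_ratio_iff[OF pos0 pos1[folded AE_iff]]
  have lower: "\<pi>0 * state_prob \<phi> Q0 k True + \<pi>1 * state_prob \<phi> Q1 k False \<le> ?risk k"
    if "\<And>j. Q0 j \<in> uncertainty_class M P0 e0" "\<And>j. Q1 j \<in> uncertainty_class M P1 e1" for Q0 Q1 k
    using that priors identical by (intro error_prob_le_risk) auto
  \<comment> \<open>The bound is uniform over contaminations, as required of \<open>\<rho>\<close>
    in \<open>contamination_contradiction\<close>.\<close>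
  have err0: "state_prob \<phi> Q k True \<le> ?risk k / \<pi>0"
    if "\<And>j. Q j \<in> uncertainty_class M P0 e0" for Q k
  proof -
    have "0 \<le> \<pi>1 * ?b k False" using priors by (simp add: state_prob_def)
    then have "\<pi>0 * state_prob \<phi> Q k True \<le> ?risk k"
      using lower[of Q "\<lambda>_. P1" k] that nom by fastforce
    then show ?thesis using priors by (simp add: field_simps)
  qed
  have err1: "state_prob \<phi> Q k False \<le> ?risk k / \<pi>1"
    if "\<And>j. Q j \<in> uncertainty_class M P1 e1" for Q k
  proof -
    have "0 \<le> \<pi>0 * ?a k True" using priors by (simp add: state_prob_def)
    then have "\<pi>1 * state_prob \<phi> Q k False \<le> ?risk k"
      using lower[of "\<lambda>_. P0" Q k] that nom by fastforce
    then show ?thesis using priors by (simp add: field_simps)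
  qed
  have risk0: "social_learning_risk M P0 P1 \<epsilon>0 \<epsilon>1 \<pi>0 \<pi>1 k \<psi> \<phi> =
      \<pi>0 * state_prob (\<phi>(k := \<psi>)) (\<lambda>_. P0) k True + \<pi>1 * state_prob (\<phi>(k := \<psi>)) (\<lambda>_. P1) k False"
    if "e0 = 0" "e1 = 0" for k \<psi>
    using that identical by (intro risk_uncontaminated nominal) auto
  have minimal: "\<pi>0 * ?a (Suc k) True + \<pi>1 * ?b (Suc k) False \<le>
      \<pi>0 * state_prob (\<phi>(Suc k := \<psi>)) (\<lambda>_. P0) (Suc k) True +
      \<pi>1 * state_prob (\<phi>(Suc k := \<psi>)) (\<lambda>_. P1) (Suc k) False"
    if "e0 = 0" "e1 = 0" "\<psi> \<in> decision_rules M" for k \<psi>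
    using minimizing[of "Suc k" \<psi>] that by (simp add: risk0)
  show ?thesis
  proof
    assume lim: "?risk \<longlonglongrightarrow> 0"
    have lim0: "(\<lambda>k. ?risk k / \<pi>0) \<longlonglongrightarrow> 0" and lim1: "(\<lambda>k. ?risk k / \<pi>1) \<longlonglongrightarrow> 0"
      using lim by (auto intro: tendsto_divide_zero)
    have a: "(\<lambda>k. ?a k True) \<longlonglongrightarrow> 0"
      using err0[of "\<lambda>_. P0"] nom
      by (intro tendsto_sandwich[OF _ _ tendsto_const lim0]) (auto simp: state_prob_def)
    have b: "(\<lambda>k. ?b k False) \<longlonglongrightarrow> 0"
      using err1[of "\<lambda>_. P1"] nom
      by (intro tendsto_sandwich[OF _ _ tendsto_const lim1]) (auto simp: state_prob_def)
    \<comment> \<open>The decision that becomes absorbing is the one right under the contaminated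
      hypothesis: \<open>False\<close> here, \<open>True\<close> for \<open>e1\<close>.\<close>
    have e0: "e0 = 0"
      using contamination_contradiction[of \<phi> M P0 P1 e0 _ False, OF rules nominal ac(2) _ e(2) lim0 _ b]
        err0 e(1) by fastforce
    have e1: "e1 = 0"
      using contamination_contradiction[of \<phi> M P1 P0 e1 _ True,
          OF rules nominal(2,1) ac(1) _ e(4) lim1 _ a] err1 e(3) by fastforce
    have "\<nexists>C. AE y in P0. p1 y \<le> C * p0 y"
    proof
      assume "\<exists>C. AE y in P0. p1 y \<le> C * p0 y"
      then obtain D where "\<And>S. S \<in> sets M \<Longrightarrow> measure P1 S \<le> D * measure P0 S"
        unfolding AE_iff
        using bounded_density_ratio[OF common_measure density0(1,2) density1(1) density0(3) prob(1)
            density1(3) prob(2)] by metis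
      then show False
        using bounded_ratio_contradiction[of \<phi> M P0 P1 \<pi>0 \<pi>1 D False] rules nominal ac priors
          a b minimal[OF e0 e1] by simp
    qed
    moreover have "\<nexists>C. AE y in P0. p0 y \<le> C * p1 y"
    proof
      assume "\<exists>C. AE y in P0. p0 y \<le> C * p1 y"
      then obtain D where "\<And>S. S \<in> sets M \<Longrightarrow> measure P0 S \<le> D * measure P1 S"
        using bounded_density_ratio[OF common_measure density1(1,2) density0(1) density1(3) prob(2)
            density0(3) prob(1)] by metis
      then show False
        using bounded_ratio_contradiction[of \<phi> M P1 P0 \<pi>1 \<pi>0 D True] rules nominal ac priors
          a b minimal[OF e0 e1] by (simp add: add.commute)
    qed
    ultimately show "e0 = 0 \<and> e1 = 0 \<and> ess_unbounded P0 (log_likelihood_ratio p1 p0)"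
      using e0 e1 unbounded_iff by blast
  next
    assume "e0 = 0 \<and> e1 = 0 \<and> ess_unbounded P0 (log_likelihood_ratio p1 p0)"
    then have e0: "e0 = 0" and e1: "e1 = 0"
      and unb: "\<nexists>C. AE y in P1. p1 y \<le> C * p0 y" "\<nexists>C. AE y in P0. p0 y \<le> C * p1 y"
      using unbounded_iff AE_iff by auto
    define r where "r k = \<pi>0 * ?a k True + \<pi>1 * ?b k False" for k
    have risk: "?risk = r" by (simp add: fun_eq_iff risk0[OF e0 e1] r_def)
    have r_nonneg: "0 \<le> r k" for k
      using priors by (simp add: r_def state_prob_def)
    have improve: "\<exists>\<delta>>0. \<forall>k. R \<le> r k \<longrightarrow> r (Suc k) \<le> r k - \<delta>" if R: "0 < R" for R
    proof -
      \<comment> \<open>Observations in \<open>S\<close> speak against the decision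
        \<open>True\<close>, those in \<open>T\<close> against \<open>False\<close>. Both sets
        depend on \<open>R\<close> only, hence so does the decrement.\<close>
      obtain S where S: "S \<in> sets M" "0 < measure P0 S" "measure P1 S \<le> R / 4 * measure P0 S"
        using unbounded_density_ratio[OF common_measure density0(1) density1(1) density0(3) prob(1)
            density1(3) prob(2) unb(2), of "R / 4"] R by auto
      obtain T where T: "T \<in> sets M" "0 < measure P1 T" "measure P0 T \<le> R / 4 * measure P1 T"
        using unbounded_density_ratio[OF common_measure density1(1) density0(1) density1(3) prob(2)
            density0(3) prob(1) unb(1), of "R / 4"] R by auto
      let ?\<delta> = "R / 4 * min (measure P0 S) (measure P1 T)"
      have "r (Suc k) \<le> r k - ?\<delta>" if "R \<le> r k" for k
      proof -
        have "R / 2 \<le> \<pi>0 * ?a k True \<or> R / 2 \<le> \<pi>1 * ?b k False"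
          using that unfolding r_def by linarith
        then consider "R / 2 \<le> \<pi>0 * ?a k True" | "R / 2 \<le> \<pi>1 * ?b k False"
          by blast
        then show ?thesis
        proof cases
          case 1
          obtain \<psi> where "\<psi> \<in> decision_rules M"
            "\<pi>0 * state_prob (\<phi>(Suc k := \<psi>)) (\<lambda>_. P0) (Suc k) True +
             \<pi>1 * state_prob (\<phi>(Suc k := \<psi>)) (\<lambda>_. P1) (Suc k) False \<le> r k - R / 4 * measure P0 S"
            using override_improvement[where w = True and \<phi> = \<phi>, OF rules nominal _ _ _ S(1,3) R 1, of \<pi>1]
              priors by (auto simp: r_def)
          moreover have "R / 4 * measure P0 S \<ge> ?\<delta>"
            using R by (intro mult_left_mono) auto
          ultimately show ?thesis using minimal[OF e0 e1, of \<psi> k] by (simp add: r_def)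
        next
          case 2
          obtain \<psi> where "\<psi> \<in> decision_rules M"
            "\<pi>0 * state_prob (\<phi>(Suc k := \<psi>)) (\<lambda>_. P0) (Suc k) True +
             \<pi>1 * state_prob (\<phi>(Suc k := \<psi>)) (\<lambda>_. P1) (Suc k) False \<le> r k - R / 4 * measure P1 T"
            using override_improvement[where w = False and \<phi> = \<phi>, OF rules nominal(2,1) _ _ _ T(1,3) R 2, of \<pi>0]
              priors by (auto simp: r_def add.commute)
          moreover have "R / 4 * measure P1 T \<ge> ?\<delta>"
            using R by (intro mult_left_mono) auto
          ultimately show ?thesis using minimal[OF e0 e1, of \<psi> k] by (simp add: r_def)
        qed
      qed
      moreover have "0 < ?\<delta>" using R S T by simp
      ultimately show ?thesis by blast
    qed
    \<comment> \<open>Zero risk would make \<open>False\<close> null under \<open>P1\<close>, hence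
      under \<open>P0\<close>, where \<open>True\<close> is null too. Positivity allows
      \<open>improve\<close> to be used with \<open>R = r k\<close>, which yields
      monotonicity.\<close>
    have r_pos: "0 < r k" for k
    proof (rule ccontr)
      assume "\<not> 0 < r k"
      moreover have "0 \<le> \<pi>0 * ?a k True" "0 \<le> \<pi>1 * ?b k False"
        using priors by (simp_all add: state_prob_def)
      ultimately have "\<pi>0 * ?a k True = 0" "\<pi>1 * ?b k False = 0"
        unfolding r_def by linarith+
      then have "?a k True = 0" "?b k False = 0" using priors by simp_all
      moreover from this(2) have "?a k False = 0"
        by (intro state_prob_eq_0_transfer[OF rules nominal ac(2)])
      ultimately show False
        using state_prob_add[of \<phi> M "\<lambda>_. P0" k True] rules nominal by simp
    qed
    have "r (Suc k) \<le> r k" for k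
      using improve[OF r_pos[of k]] by force
    then have dec: "decseq r" by (rule decseq_SucI)
    then obtain L where L: "r \<longlonglongrightarrow> L" "\<And>k. L \<le> r k"
      using decseq_convergent[OF dec, of 0] r_nonneg by auto
    have "L = 0"
    \<comment> \<open>A positive limit would bound the risk from below at all stages, so every step
      would lower it by the same \<open>\<delta>\<close>.\<close>
    proof (rule ccontr)
      assume "L \<noteq> 0"
      then have "0 < L" using LIMSEQ_le_const[OF L(1)] r_nonneg by fastforce
      then obtain \<delta> where \<delta>: "0 < \<delta>" "\<And>k. r (Suc k) \<le> r k - \<delta>"
        using improve[of L] L(2) by blast
      have "L \<le> L - \<delta>"
        by (rule LIMSEQ_le[OF LIMSEQ_Suc[OF L(1)] tendsto_diff[OF L(1) tendsto_const]])
          (use \<delta>(2) in auto)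
      then show False using \<delta>(1) by simp
    qed
    then show "?risk \<longlonglongrightarrow> 0" using L(1) risk by simp
  qed
qed

end
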